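(* Let $X$ be a topological space that is a Baire space. Then $\mathcal{ML}(X)$, equipped with the restriction of $\tau_w$, is a Baire space.
   Context: No separation axioms are assumed on topological spaces. A Baire space is a topological space in which the intersection of any sequence of dense open subsets is dense. For a topological space $X$, $\mathcal{F}(X)$ is the set of all closed subsets of $X$ (including $\emptyset$). A subset $L\subset X$ is a limit set if there is a net in $X$ that converges to every point of $L$; equivalently, every finite family of open subsets of $X$ each of which intersects $L$ has nonempty intersection. $\mathcal{ML}(X)$ is the set of all limit sets of $X$ that are maximal with respect to inclusion among limit sets; these are automatically closed, so $\mathcal{ML}(X)\subset\mathcal{F}(X)$. The topology $\tau_w$ (lower semifinite topology) on $\mathcal{F}(X)$ is the one having as a base the sets $\mathcal{U}(\emptyset,\Phi)=\{A\in\mathcal{F}(X)\mid A\cap O\neq\emptyset \text{ for all } O\in\Phi\}$, where $\Phi$ runs through all finite (possibly empty) families of open subsets of $X$. *)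

theory Defs
  imports "HOL-Analysis.Analysis"
begin

definition Baire_space :: "'a topology \<Rightarrow> bool" where
  "Baire_space X \<longleftrightarrow>
     (\<forall>G :: nat \<Rightarrow> 'a set.
        (\<forall>n. openin X (G n) \<and> X closure_of (G n) = topspace X) \<longrightarrow>
        X closure_of (\<Inter>n. G n) = topspace X)"


subsection \<open>Nets and limit sets\<close>

definition directed_set :: "'i set \<Rightarrow> 'i rel \<Rightarrow> bool" where
  "directed_set D r \<longleftrightarrow>
     D \<noteq> {} \<and> refl_on D r \<and> trans_on D r \<and>
     (\<forall>a\<in>D. \<forall>b\<in>D. \<exists>c\<in>D. (a, c) \<in> r \<and> (b, c) \<in> r)"

definition net_in :: "'a topology \<Rightarrow> 'i set \<Rightarrow> 'i rel \<Rightarrow> ('i \<Rightarrow> 'a) \<Rightarrow> bool" where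
  "net_in X D r f \<longleftrightarrow> directed_set D r \<and> f \<in> D \<rightarrow> topspace X"

text \<open>The filter generated by the tails of a directed set; net convergence is
  \<^const>\<open>limitin\<close> along this filter.\<close>

definition tails :: "'i set \<Rightarrow> 'i rel \<Rightarrow> 'i filter" where
  "tails D r = (INF d\<in>D. principal {e \<in> D. (d, e) \<in> r})"

lemma eventually_tails:
  assumes "directed_set D r"
  shows "eventually P (tails D r) \<longleftrightarrow> (\<exists>d\<in>D. \<forall>e\<in>D. (d, e) \<in> r \<longrightarrow> P e)"
proof -
  have "\<exists>c\<in>D. principal {e \<in> D. (c, e) \<in> r}
          \<le> inf (principal {e \<in> D. (a, e) \<in> r}) (principal {e \<in> D. (b, e) \<in> r})"
    if ab: "a \<in> D" "b \<in> D" for a b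
  proof -
    obtain c where c: "c \<in> D" "(a, c) \<in> r" "(b, c) \<in> r"
      using assms ab unfolding directed_set_def by blast
    have tr: "trans_on D r"
      using assms unfolding directed_set_def by blast
    have "(a, e) \<in> r \<and> (b, e) \<in> r" if "e \<in> D" "(c, e) \<in> r" for e
      using tr ab c that by (meson trans_onD)
    then show ?thesis
      using c by (intro bexI[of _ c]) auto
  qed
  moreover have "D \<noteq> {}"
    using assms unfolding directed_set_def by blast
  ultimately show ?thesis
    unfolding tails_def
    by (subst eventually_INF_base) (auto simp: eventually_principal)
qed

text \<open>HOL cannot quantify over the type of the index set. Nets indexed by sets of points
  are enough: \<open>limit_setI\<close> below shows that a net over any index type yields a limit set.\<close>

definition limit_set :: "'a topology \<Rightarrow> 'a set \<Rightarrow> bool" where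
  "limit_set X L \<longleftrightarrow>
     L \<subseteq> topspace X \<and>
     (\<exists>(D :: 'a set set) r f. net_in X D r f \<and> (\<forall>l\<in>L. limitin X f l (tails D r)))"

lemma net_imp_finite_families:
  fixes D :: "'i set"
  assumes net: "net_in X D r f" and lim: "\<forall>l\<in>L. limitin X f l (tails D r)"
    and \<Phi>: "finite \<Phi>" "\<forall>U\<in>\<Phi>. openin X U \<and> U \<inter> L \<noteq> {}"
  shows "topspace X \<inter> \<Inter>\<Phi> \<noteq> {}"
proof -
  have dir: "directed_set D r"
    using net by (simp add: net_in_def)
  have "\<forall>U\<in>\<Phi>. eventually (\<lambda>d. f d \<in> U) (tails D r)"
  proof
    fix U assume "U \<in> \<Phi>"
    then obtain l where "l \<in> U" "l \<in> L" "openin X U"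
      using \<Phi> by blast
    then show "eventually (\<lambda>d. f d \<in> U) (tails D r)"
      using lim by (auto simp: limitin_def)
  qed
  then have "eventually (\<lambda>d. \<forall>U\<in>\<Phi>. f d \<in> U) (tails D r)"
    using \<Phi> by (simp add: eventually_ball_finite)
  then obtain d where d: "d \<in> D" "\<forall>e\<in>D. (d, e) \<in> r \<longrightarrow> (\<forall>U\<in>\<Phi>. f e \<in> U)"
    unfolding eventually_tails[OF dir] by blast
  have "(d, d) \<in> r"
    using dir d by (auto simp: directed_set_def dest: refl_onD)
  with d net show ?thesis
    by (auto simp: net_in_def)
qed

lemma finite_families_imp_limit_set:
  assumes L: "L \<subseteq> topspace X"
    and fam: "\<And>\<Phi>. finite \<Phi> \<Longrightarrow> \<forall>U\<in>\<Phi>. openin X U \<and> U \<inter> L \<noteq> {} \<Longrightarrow> topspace X \<inter> \<Inter>\<Phi> \<noteq> {}"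
  shows "limit_set X L"
proof -
  define P where "P \<Phi> \<longleftrightarrow> finite \<Phi> \<and> (\<forall>U\<in>\<Phi>. openin X U \<and> U \<inter> L \<noteq> {})" for \<Phi>
  define D where "D = {topspace X \<inter> \<Inter>\<Phi> | \<Phi>. P \<Phi>}"
  define r where "r = {(V, W). W \<subseteq> (V :: 'a set)}"
  define f where "f W = (SOME x. x \<in> W)" for W :: "'a set"
  have f: "f W \<in> W \<and> f W \<in> topspace X" if "W \<in> D" for W
  proof -
    have "W \<noteq> {}" "W \<subseteq> topspace X"
      using that fam by (auto simp: D_def P_def)
    then show ?thesis
      unfolding f_def using some_in_eq by blast
  qed
  have "\<exists>c\<in>D. (a, c) \<in> r \<and> (b, c) \<in> r" if ab: "a \<in> D" "b \<in> D" for a b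
  proof -
    obtain \<Phi> \<Psi> where "P \<Phi>" "a = topspace X \<inter> \<Inter>\<Phi>" "P \<Psi>" "b = topspace X \<inter> \<Inter>\<Psi>"
      using ab unfolding D_def by blast
    then have "P (\<Phi> \<union> \<Psi>)" "topspace X \<inter> \<Inter>(\<Phi> \<union> \<Psi>) \<subseteq> a" "topspace X \<inter> \<Inter>(\<Phi> \<union> \<Psi>) \<subseteq> b"
      by (auto simp: P_def)
    moreover from this(1) have "topspace X \<inter> \<Inter>(\<Phi> \<union> \<Psi>) \<in> D"
      unfolding D_def by blast
    ultimately show ?thesis
      unfolding r_def by blast
  qed
  moreover have "D \<noteq> {}"
    unfolding D_def P_def by (auto intro: exI[of _ "{}"])
  ultimately have dir: "directed_set D r"
    by (auto simp: directed_set_def r_def intro!: refl_onI trans_onI)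
  have "limitin X f l (tails D r)" if l: "l \<in> L" for l
    unfolding limitin_def
  proof (intro conjI allI impI)
    show "l \<in> topspace X"
      using l L by blast
    fix U assume "openin X U \<and> l \<in> U"
    then have "P {U}"
      using l by (auto simp: P_def)
    then have W: "topspace X \<inter> \<Inter>{U} \<in> D"
      unfolding D_def by blast
    have fU: "f e \<in> U" if "e \<in> D" "e \<subseteq> topspace X \<inter> \<Inter>{U}" for e
      using f[OF that(1)] that(2) by blast
    show "eventually (\<lambda>x. f x \<in> U) (tails D r)"
      unfolding eventually_tails[OF dir] by (rule bexI[OF _ W]) (simp add: r_def fU)
  qed
  moreover have "net_in X D r f"
    using dir f by (auto simp: net_in_def)
  ultimately show ?thesis
    using L unfolding limit_set_def by blast
qed

lemma limit_set_iff_finite_families: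
  "limit_set X L \<longleftrightarrow>
     L \<subseteq> topspace X \<and>
     (\<forall>\<Phi>. finite \<Phi> \<and> (\<forall>U\<in>\<Phi>. openin X U \<and> U \<inter> L \<noteq> {}) \<longrightarrow> topspace X \<inter> \<Inter>\<Phi> \<noteq> {})"
  (is "_ \<longleftrightarrow> _ \<and> ?fam")
proof
  assume "limit_set X L"
  then obtain D :: "'a set set" and r f where L: "L \<subseteq> topspace X"
      and net: "net_in X D r f" "\<forall>l\<in>L. limitin X f l (tails D r)"
    unfolding limit_set_def by (elim conjE exE)
  have ?fam
    using net_imp_finite_families[OF net] by simp
  with L show "L \<subseteq> topspace X \<and> ?fam"
    by (rule conjI)
next
  assume R: "L \<subseteq> topspace X \<and> ?fam"
  then show "limit_set X L"
    by (intro finite_families_imp_limit_set) simp_all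
qed

lemma limit_setI:
  fixes D :: "'i set"
  assumes "L \<subseteq> topspace X" "net_in X D r f" "\<forall>l\<in>L. limitin X f l (tails D r)"
  shows "limit_set X L"
  by (rule finite_families_imp_limit_set[OF assms(1) net_imp_finite_families[OF assms(2,3)]])

definition maximal_limit_sets :: "'a topology \<Rightarrow> 'a set set" where
  "maximal_limit_sets X =
     {L. limit_set X L \<and> (\<forall>M. limit_set X M \<and> L \<subseteq> M \<longrightarrow> M = L)}"


subsection \<open>The lower semifinite topology\<close>

definition closed_subsets :: "'a topology \<Rightarrow> 'a set set" where
  "closed_subsets X = {A. closedin X A}"

text \<open>This is the set written \<open>\<U>(\<emptyset>, \<Phi>)\<close>.\<close>

definition hitting :: "'a topology \<Rightarrow> 'a set set \<Rightarrow> 'a set set" where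
  "hitting X \<Phi> = {A \<in> closed_subsets X. \<forall>U\<in>\<Phi>. A \<inter> U \<noteq> {}}"

definition lower_semifinite_base :: "'a topology \<Rightarrow> 'a set set set" where
  "lower_semifinite_base X = {hitting X \<Phi> | \<Phi>. finite \<Phi> \<and> (\<forall>U\<in>\<Phi>. openin X U)}"

definition lower_semifinite_topology :: "'a topology \<Rightarrow> 'a set topology" where
  "lower_semifinite_topology X =
     topology (arbitrary union_of (\<lambda>B. B \<in> lower_semifinite_base X))"

lemma openin_lower_semifinite_topology:
  "openin (lower_semifinite_topology X) =
     arbitrary union_of (\<lambda>B. B \<in> lower_semifinite_base X)"
proof -
  have "B \<inter> C \<in> lower_semifinite_base X"
    if BC: "B \<in> lower_semifinite_base X" "C \<in> lower_semifinite_base X" for B C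
  proof -
    obtain \<Phi> \<Psi> where "B = hitting X \<Phi>" "finite \<Phi>" "\<forall>U\<in>\<Phi>. openin X U"
        "C = hitting X \<Psi>" "finite \<Psi>" "\<forall>U\<in>\<Psi>. openin X U"
      using BC unfolding lower_semifinite_base_def by blast
    then have "B \<inter> C = hitting X (\<Phi> \<union> \<Psi>) \<and> finite (\<Phi> \<union> \<Psi>) \<and> (\<forall>U\<in>\<Phi> \<union> \<Psi>. openin X U)"
      by (auto simp: hitting_def)
    then show ?thesis
      unfolding lower_semifinite_base_def by blast
  qed
  then show ?thesis
    unfolding lower_semifinite_topology_def
    by (intro topology_inverse' istopology_base) auto
qed

lemma topspace_lower_semifinite_topology:
  "topspace (lower_semifinite_topology X) = closed_subsets X"
proof
  show "topspace (lower_semifinite_topology X) \<subseteq> closed_subsets X"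
    unfolding topspace_def openin_lower_semifinite_topology
    by (auto simp: union_of_def lower_semifinite_base_def hitting_def)
  have "closed_subsets X = hitting X {}"
    by (auto simp: hitting_def)
  then have "closed_subsets X \<in> lower_semifinite_base X"
    unfolding lower_semifinite_base_def by blast
  then have "openin (lower_semifinite_topology X) (closed_subsets X)"
    unfolding openin_lower_semifinite_topology by (intro arbitrary_union_of_inc)
  then show "closed_subsets X \<subseteq> topspace (lower_semifinite_topology X)"
    by (rule openin_subset)
qed

lemma limit_set_closure_of:
  assumes "limit_set X L"
  shows "limit_set X (X closure_of L)"
proof (rule finite_families_imp_limit_set)
  fix \<Phi>
  assume \<Phi>: "finite \<Phi>" "\<forall>U\<in>\<Phi>. openin X U \<and> U \<inter> X closure_of L \<noteq> {}"
  then have "\<forall>U\<in>\<Phi>. openin X U \<and> U \<inter> L \<noteq> {}"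
    by (metis openin_Int_closure_of_eq_empty)
  with \<Phi>(1) assms show "topspace X \<inter> \<Inter>\<Phi> \<noteq> {}"
    by (simp add: limit_set_iff_finite_families)
qed (rule closure_of_subset_topspace)

lemma maximal_limit_sets_subset: "maximal_limit_sets X \<subseteq> closed_subsets X"
proof
  fix L assume L: "L \<in> maximal_limit_sets X"
  then have "L \<subseteq> topspace X" "limit_set X L"
    by (auto simp: maximal_limit_sets_def limit_set_def)
  then have "X closure_of L = L"
    using L by (simp add: maximal_limit_sets_def limit_set_closure_of closure_of_subset)
  then show "L \<in> closed_subsets X"
    by (metis closed_subsets_def closedin_closure_of mem_Collect_eq)
qed

end

theory Submission
  imports Defs
begin

text \<open>For open \<open>W\<close> let \<open>[W]\<close> be the set of maximal limit sets meeting \<open>W\<close>. By Zorn's lemma every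
  point lies in a maximal limit set, and by the finite-family property of limit sets every
  nonempty open set of maximal limit sets contains some \<open>[W]\<close> with \<open>W\<close> nonempty. Given dense open
  sets \<open>G\<^sub>n\<close> of maximal limit sets, the union \<open>O\<^sub>n\<close> of all open \<open>W\<close> with \<open>[W] \<subseteq> G\<^sub>n\<close> is therefore
  dense open in \<open>X\<close>. A maximal limit set through a point of all the \<open>O\<^sub>n\<close> belongs to all the \<open>G\<^sub>n\<close>.\<close>

lemma limit_set_singleton:
  assumes "x \<in> topspace X"
  shows "limit_set X {x}"
  using assms by (auto simp: limit_set_iff_finite_families)

text \<open>This is the chain condition for Zorn's lemma. Each of finitely many open sets meeting
  the union meets some member of the chain; the largest of these members meets all of them, and it
  is itself a limit set.\<close>

lemma limit_set_Union_chain: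
  assumes chain: "subset.chain {L. limit_set X L} C" and "C \<noteq> {}"
  shows "limit_set X (\<Union>C)"
proof (rule finite_families_imp_limit_set)
  have lim: "limit_set X L" if "L \<in> C" for L
    using chain that by (auto simp: subset.chain_def)
  then show "\<Union>C \<subseteq> topspace X"
    by (auto simp: limit_set_def)
  fix \<Phi> assume \<Phi>: "finite \<Phi>" "\<forall>U\<in>\<Phi>. openin X U \<and> U \<inter> \<Union>C \<noteq> {}"
  have "\<exists>L\<in>C. \<forall>U\<in>\<Phi>. U \<inter> L \<noteq> {}"
    using \<Phi>
  proof (induction rule: finite_induct)
    case empty
    then show ?case using \<open>C \<noteq> {}\<close> by blast
  next
    case (insert U \<Phi>)
    then obtain L where L: "L \<in> C" "\<forall>V\<in>\<Phi>. V \<inter> L \<noteq> {}"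
      by auto
    obtain M where M: "M \<in> C" "U \<inter> M \<noteq> {}"
      using insert.prems by auto
    have "L \<subseteq> M \<or> M \<subseteq> L"
      using chain L(1) M(1) by (auto simp: subset_chain_def)
    then show ?case
    proof
      assume "L \<subseteq> M"
      then show ?thesis
        using L M by (intro bexI[of _ M]) auto
    next
      assume "M \<subseteq> L"
      then show ?thesis
        using L M by (intro bexI[of _ L]) auto
    qed
  qed
  then show "topspace X \<inter> \<Inter>\<Phi> \<noteq> {}"
    using lim \<Phi> by (metis limit_set_iff_finite_families)
qed

text \<open>Zorn's lemma is applied only to limit sets above \<open>K\<close>. A maximal one is
  maximal among all limit sets, since anything larger still contains \<open>K\<close>.\<close>

lemma ex_maximal_limit_set_superset:
  assumes "limit_set X K"
  obtains L where "L \<in> maximal_limit_sets X" "K \<subseteq> L"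
proof -
  let ?A = "{L. limit_set X L \<and> K \<subseteq> L}"
  have "\<exists>L\<in>?A. \<forall>M\<in>?A. L \<subseteq> M \<longrightarrow> M = L"
  proof (rule subset_Zorn_nonempty)
    show "?A \<noteq> {}"
      using assms by blast
    show "\<Union>C \<in> ?A" if "C \<noteq> {}" "subset.chain ?A C" for C
      using that limit_set_Union_chain[of X C] by (auto simp: subset_chain_def)
  qed
  then obtain L where "limit_set X L" "K \<subseteq> L" "\<forall>M\<in>?A. L \<subseteq> M \<longrightarrow> M = L"
    by blast
  then show thesis
    by (intro that[of L]) (auto simp: maximal_limit_sets_def)
qed

lemma ex_maximal_limit_set_mem:
  assumes "x \<in> topspace X"
  obtains L where "L \<in> maximal_limit_sets X" "x \<in> L"
  using ex_maximal_limit_set_superset[OF limit_set_singleton[OF assms]]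
  by (metis insert_subset)

lemma maximal_limit_set_meets_topspace:
  assumes "L \<in> maximal_limit_sets X"
  shows "L \<inter> topspace X \<noteq> {}"
proof
  assume "L \<inter> topspace X = {}"
  have lim: "limit_set X L"
    using assms by (simp add: maximal_limit_sets_def)
  \<comment> \<open>The empty family is admissible and has intersection \<open>UNIV\<close>, so the
    mere existence of a limit set makes the space nonempty.\<close>
  then have "topspace X \<inter> \<Inter>{} \<noteq> {}"
    unfolding limit_set_iff_finite_families by blast
  then obtain x where "x \<in> topspace X"
    by fast
  then have "limit_set X {x}"
    by (rule limit_set_singleton)
  moreover have "L = {}"
    using lim \<open>L \<inter> topspace X = {}\<close> by (auto simp: limit_set_def)
  ultimately show False
    using assms by (auto simp: maximal_limit_sets_def)
qed

abbreviation maximal_limit_space :: "'a topology \<Rightarrow> 'a set topology" where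
  "maximal_limit_space X \<equiv> subtopology (lower_semifinite_topology X) (maximal_limit_sets X)"

lemma topspace_maximal_limit_space:
  "topspace (maximal_limit_space X) = maximal_limit_sets X"
  using maximal_limit_sets_subset
  by (auto simp: topspace_lower_semifinite_topology)

text \<open>This is the set written \<open>[W]\<close> in the overview.\<close>

definition maximal_meeting :: "'a topology \<Rightarrow> 'a set \<Rightarrow> 'a set set" where
  "maximal_meeting X W = {L \<in> maximal_limit_sets X. L \<inter> W \<noteq> {}}"

lemma openin_maximal_meeting:
  assumes "openin X W"
  shows "openin (maximal_limit_space X) (maximal_meeting X W)"
proof -
  have "hitting X {W} \<in> lower_semifinite_base X"
    using assms unfolding lower_semifinite_base_def by blast
  then have "openin (lower_semifinite_topology X) (hitting X {W})"
    unfolding openin_lower_semifinite_topology by (rule arbitrary_union_of_inc)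
  moreover have "maximal_meeting X W = hitting X {W} \<inter> maximal_limit_sets X"
    using maximal_limit_sets_subset by (auto simp: maximal_meeting_def hitting_def)
  ultimately show ?thesis
    by (auto simp: openin_subtopology)
qed

lemma maximal_meeting_nonempty:
  assumes "openin X W" "W \<noteq> {}"
  shows "maximal_meeting X W \<noteq> {}"
proof -
  obtain x where x: "x \<in> W" "x \<in> topspace X"
    using assms openin_subset[OF assms(1)] by blast
  obtain L where "L \<in> maximal_limit_sets X" "x \<in> L"
    using x(2) by (rule ex_maximal_limit_set_mem)
  with x(1) show ?thesis
    by (auto simp: maximal_meeting_def)
qed

text \<open>A basic neighbourhood of \<open>L\<close> is given by finitely many open sets meeting
  \<open>L\<close>. Since \<open>L\<close> is a limit set, these and \<open>V\<close> have a common
  point, and their intersection serves as \<open>W\<close>: whatever meets \<open>W\<close> meets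
  each of them.\<close>

lemma maximal_limit_space_pi_base:
  assumes S: "openin (maximal_limit_space X) S" and L: "L \<in> S" and V: "openin X V" "L \<inter> V \<noteq> {}"
  obtains W where "openin X W" "W \<noteq> {}" "W \<subseteq> V" "maximal_meeting X W \<subseteq> S"
proof -
  obtain T where T: "openin (lower_semifinite_topology X) T" "S = T \<inter> maximal_limit_sets X"
    using S by (auto simp: openin_subtopology)
  then obtain B where "B \<in> lower_semifinite_base X" "L \<in> B" "B \<subseteq> T"
    using L by (auto simp: openin_lower_semifinite_topology union_of_def)
  then obtain \<Phi> where \<Phi>: "finite \<Phi>" "\<forall>U\<in>\<Phi>. openin X U" "L \<in> hitting X \<Phi>" "hitting X \<Phi> \<subseteq> T"
    by (auto simp: lower_semifinite_base_def)
  \<comment> \<open>Inserting \<open>V\<close> also keeps the family nonempty, so that its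
    intersection is open in \<open>X\<close> even if \<open>\<Phi>\<close> is empty.\<close>
  let ?W = "\<Inter>(insert V \<Phi>)"
  show thesis
  proof
    show "openin X ?W"
      using \<Phi> V by (intro openin_Inter) auto
    have "limit_set X L"
      using L T(2) by (simp add: maximal_limit_sets_def)
    moreover have "\<forall>U\<in>insert V \<Phi>. openin X U \<and> U \<inter> L \<noteq> {}"
      using \<Phi> V by (auto simp: hitting_def)
    ultimately show "?W \<noteq> {}"
      using \<Phi>(1) unfolding limit_set_iff_finite_families by (metis finite_insert inf_bot_right)
    show "maximal_meeting X ?W \<subseteq> S"
    proof
      fix M assume M: "M \<in> maximal_meeting X ?W"
      then have "M \<in> hitting X \<Phi>"
        using maximal_limit_sets_subset by (fastforce simp: maximal_meeting_def hitting_def)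
      with M show "M \<in> S"
        using \<Phi>(4) T(2) by (auto simp: maximal_meeting_def)
    qed
  qed blast
qed

theorem proposition4p4:
  fixes X :: "'a topology"
  assumes "Baire_space X"
  shows "Baire_space (subtopology (lower_semifinite_topology X) (maximal_limit_sets X))"
  unfolding Baire_space_def
proof (intro allI impI)
  let ?Y = "maximal_limit_space X"
  fix G :: "nat \<Rightarrow> 'a set set"
  assume G: "\<forall>n. openin ?Y (G n) \<and> ?Y closure_of (G n) = topspace ?Y"
  \<comment> \<open>\<open>H n\<close> is the set \<open>O\<^sub>n\<close> of the overview.\<close>
  define H where "H n = \<Union>{W. openin X W \<and> maximal_meeting X W \<subseteq> G n}" for n
  have "openin X (H n) \<and> X closure_of (H n) = topspace X" for n
    unfolding dense_intersects_open
  proof (intro conjI allI impI)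
    show "openin X (H n)"
      unfolding H_def by blast
    fix V assume V: "openin X V \<and> V \<noteq> {}"
    then have "openin ?Y (maximal_meeting X V)" "maximal_meeting X V \<noteq> {}"
      by (simp_all add: openin_maximal_meeting maximal_meeting_nonempty)
    moreover have "?Y closure_of (G n) = topspace ?Y"
      using G by blast
    ultimately have "G n \<inter> maximal_meeting X V \<noteq> {}"
      unfolding dense_intersects_open by blast
    then obtain L where "L \<in> G n" "L \<inter> V \<noteq> {}"
      by (auto simp: maximal_meeting_def)
    then obtain W where "openin X W" "W \<noteq> {}" "W \<subseteq> V" "maximal_meeting X W \<subseteq> G n"
      using maximal_limit_space_pi_base G V by metis
    then show "H n \<inter> V \<noteq> {}"
      unfolding H_def by blast
  qed
  then have dense: "X closure_of (\<Inter>n. H n) = topspace X"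
    using assms unfolding Baire_space_def by blast
  show "?Y closure_of (\<Inter>n. G n) = topspace ?Y"
    unfolding dense_intersects_open
  proof (intro allI impI)
    fix S assume S: "openin ?Y S \<and> S \<noteq> {}"
    then obtain K where K: "K \<in> S" "K \<in> maximal_limit_sets X"
      using openin_subset topspace_maximal_limit_space by blast
    then have "K \<inter> topspace X \<noteq> {}"
      by (simp add: maximal_limit_set_meets_topspace)
    \<comment> \<open>Here the role of \<open>V\<close> is taken by the whole space.\<close>
    then obtain W where W: "openin X W" "W \<noteq> {}" "maximal_meeting X W \<subseteq> S"
      using maximal_limit_space_pi_base S K by (metis openin_topspace)
    then have "(\<Inter>n. H n) \<inter> W \<noteq> {}"
      using dense unfolding dense_intersects_open by blast
    then obtain x where x: "x \<in> W" "\<And>n. x \<in> H n"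
      by auto
    then have "x \<in> topspace X"
      using openin_subset[OF W(1)] by blast
    then obtain L where L: "L \<in> maximal_limit_sets X" "x \<in> L"
      by (rule ex_maximal_limit_set_mem)
    \<comment> \<open>For each \<open>n\<close> the point \<open>x\<close> lies in some open set all
      of whose maximal limit sets belong to \<open>G n\<close>; \<open>L\<close> meets it at
      \<open>x\<close>, so one \<open>L\<close> serves every \<open>n\<close>.\<close>
    have "L \<in> G n" for n
      using x(2)[of n] L by (auto simp: H_def maximal_meeting_def)
    moreover have "L \<in> S"
      using W(3) L x(1) by (auto simp: maximal_meeting_def)
    ultimately show "(\<Inter>n. G n) \<inter> S \<noteq> {}"
      by blast
  qed
qed

end
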